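(* The limiting Evans function $D^0$ satisfies $D^0(\lambda)\ne0$ for all $\lambda\in\mathbb{C}$ with $\operatorname{Re}\lambda\ge0$.
   Context: Let $\hat v_0(x)=\frac{1-\tanh(x/2)}{2}$ and $$A^0(x,\lambda)=\begin{pmatrix}0&\lambda&1\\0&0&1\\ \lambda\hat v_0&\lambda\hat v_0&2\hat v_0-1-\lambda\end{pmatrix}.$$ For $\operatorname{Re}\lambda\ge0$, the matrix $A^0(-\infty,\lambda)$ has the unique (simple) eigenvalue $\mu=\frac{1+\sqrt{1+4\lambda}}{2}$ of positive real part; let $V_1^{0-}(\lambda)$ be a corresponding nonzero eigenvector, analytic in $\lambda$, and let $W_1^{0-}$ be the solution of $W'=A^0W$ with $e^{-\mu x}W_1^{0-}(x)\to V_1^{0-}$ as $x\to-\infty$ (so $W_1^{0-}$ spans the one-dimensional space of solutions decaying at $-\infty$). Let $\widetilde W_1^{0+}$ be the unique solution of the adjoint system $\widetilde W'=-(A^0)^*\widetilde W$ ($^*$ conjugate transpose) with $\widetilde W_1^{0+}(x)\to(0,1,(1+\bar\lambda)^{-1})^T$ as $x\to+\infty$. The limiting Evans function is $D^0(\lambda)=(\widetilde W_1^{0+})^*W_1^{0-}|_{x=0}$. *)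

theory Defs
  imports "HOL-Complex_Analysis.Complex_Analysis"
begin

definition v0_hat :: "real \<Rightarrow> real" where
  "v0_hat x = (1 - tanh (x / 2)) / 2"

definition A0 :: "real \<Rightarrow> complex \<Rightarrow> complex^3^3" where
  "A0 x l = (let v = complex_of_real (v0_hat x) in
     vector [vector [0,     l,     1],
             vector [0,     0,     1],
             vector [l * v, l * v, 2 * v - 1 - l]])"

definition A0_minus_inf :: "complex \<Rightarrow> complex^3^3" where
  "A0_minus_inf l = Lim at_bot (\<lambda>x. A0 x l)"

text \<open>The principal square root has nonnegative real part, so for \<open>Re l \<ge> 0\<close> this is
  the eigenvalue of \<open>A0_minus_inf l\<close> of positive real part; the other two are
  \<open>(1 - csqrt (1 + 4 * l)) / 2\<close> and \<open>- l\<close>.\<close>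

definition mu :: "complex \<Rightarrow> complex" where
  "mu l = (1 + csqrt (1 + 4 * l)) / 2"

definition conj_transpose :: "complex^'n^'m \<Rightarrow> complex^'m^'n" where
  "conj_transpose A = (\<chi> i j. cnj (A $ j $ i))"

text \<open>The scalar \<open>w\<^sup>* u\<close>, conjugate-linear in the first argument.\<close>

definition herm_prod :: "complex^'n \<Rightarrow> complex^'n \<Rightarrow> complex" where
  "herm_prod w u = (\<Sum>i\<in>UNIV. cnj (w $ i) * u $ i)"

text \<open>Analyticity on the closed half-plane means holomorphy on an open neighbourhood of it.\<close>

definition analytic_eigenvector :: "(complex \<Rightarrow> complex^3) \<Rightarrow> bool" where
  "analytic_eigenvector V \<longleftrightarrow>
     (\<forall>i. (\<lambda>l. V l $ i) analytic_on {l. 0 \<le> Re l}) \<and>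
     (\<forall>l. 0 \<le> Re l \<longrightarrow> V l \<noteq> 0 \<and> A0_minus_inf l *v V l = mu l *s V l)"

definition solution_minus :: "complex \<Rightarrow> complex^3 \<Rightarrow> (real \<Rightarrow> complex^3) \<Rightarrow> bool" where
  "solution_minus l V W \<longleftrightarrow>
     (\<forall>x. (W has_vector_derivative A0 x l *v W x) (at x)) \<and>
     ((\<lambda>x. exp (- mu l * complex_of_real x) *s W x) \<longlongrightarrow> V) at_bot"

definition adjoint_solution_plus :: "complex \<Rightarrow> (real \<Rightarrow> complex^3) \<Rightarrow> bool" where
  "adjoint_solution_plus l Z \<longleftrightarrow>
     (\<forall>x. (Z has_vector_derivative (- conj_transpose (A0 x l)) *v Z x) (at x)) \<and>
     (Z \<longlongrightarrow> vector [0, 1, inverse (1 + cnj l)]) at_top"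

definition Evans0 ::
  "(complex \<Rightarrow> real \<Rightarrow> complex^3) \<Rightarrow> (complex \<Rightarrow> real \<Rightarrow> complex^3) \<Rightarrow> complex \<Rightarrow> complex" where
  "Evans0 Z W l = herm_prod (Z l 0) (W l 0)"

end

theory Submission imports Defs begin

text \<open>
  Write \<open>W = (u, v, w)\<close> for a solution of \<open>W' = A\<^sup>0 W\<close> and \<open>z = u' = l v + w\<close>.
  The proof is an energy estimate of Matsumura--Nishihara type. The profile is the logistic
  function \<open>v0_hat x = 1 / (1 + exp x)\<close>, and eliminating \<open>w\<close> turns the
  system into \<open>l u + u' - (1 / v0_hat - 1) v' = u'' / v0_hat\<close>. Multiplying by
  \<open>exp (- x) = v0_hat / (1 - v0_hat)\<close> makes the coefficient of \<open>v'\<close> constant, and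
  since \<open>exp (- x) / v0_hat = 1 + exp (- x)\<close> the equation becomes
  \<open>((1 + exp (- x)) u')' = exp (- x) l u - v'\<close>. Pairing it with \<open>u\<close> and integrating the
  \<open>v'\<close> term by parts shows that the real quantity
  \<open>F = Re (((1 + exp (- x)) u' + v) cnj u) - \<bar>v\<bar>\<^sup>2 / 2\<close> satisfies
  \<open>F' = Re l (exp (- x) \<bar>u\<bar>\<^sup>2 + \<bar>v\<bar>\<^sup>2) + (1 + exp (- x)) \<bar>u'\<bar>\<^sup>2 \<ge> 0\<close>
  (lemma \<open>energy_deriv\<close>).

  At \<open>-\<infinity>\<close> the solution \<open>W\<close> is \<open>O(exp x)\<close> because \<open>Re (mu l) \<ge> 1\<close>, so
  \<open>F\<close> tends to \<open>0\<close> (\<open>energy_at_bot\<close>). At \<open>+\<infinity>\<close> the leading term of \<open>F\<close> is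
  the product of \<open>z + v = (1 + l) v + w\<close> with the conjugate of \<open>u\<close>, and
  \<open>v + w / (1 + l)\<close> is exactly the pairing of \<open>W\<close> with the limit
  \<open>(0, 1, 1 / (1 + cnj l))\<close> of the adjoint solution. The pairing of \<open>W\<close> with the adjoint
  solution itself is constant in \<open>x\<close>; if the Evans function vanishes, it is zero. Since
  \<open>W\<close> grows slowly (\<open>growth_bound\<close>) while the adjoint solution converges
  exponentially fast in its first two components (\<open>adjoint_rates\<close>), the upper limit of
  \<open>F\<close> at \<open>+\<infinity>\<close> is then at most \<open>0\<close> (\<open>energy_nonpos_if_pairing_zero\<close>).

  A nondecreasing function that starts from \<open>0\<close> and never exceeds \<open>0\<close> is zero, so
  \<open>F' = 0\<close> and \<open>u' = 0\<close>. The system and the decay at \<open>-\<infinity>\<close> then give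
  \<open>W = 0\<close> (\<open>trivial_if_energy_nonpos\<close>), which contradicts the nonzero eigenvector in the
  normalisation of \<open>W\<close> at \<open>-\<infinity>\<close>.
\<close>

section \<open>The profile, the decay rate, and calculus on the line\<close>

lemma v0_hat_logistic: "v0_hat x = 1 / (1 + exp x)"
proof -
  have "exp x = exp (x / 2) / exp (- (x / 2))" by (simp flip: exp_diff)
  then have "1 + exp x = (exp (- (x / 2)) + exp (x / 2)) / exp (- (x / 2))"
    by (simp add: add_divide_distrib)
  moreover have "exp (x / 2) + exp (- (x / 2)) \<noteq> 0"
    by (smt (verit) exp_gt_zero)
  moreover have "1 + exp x \<noteq> 0"
    by (smt (verit) exp_gt_zero)
  ultimately show ?thesis
    by (simp add: v0_hat_def tanh_def sinh_field_def cosh_field_def divide_simps)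
       (simp add: algebra_simps)
qed

text \<open>The last identity says that \<open>1 + exp (- x)\<close> is the weight \<open>exp (- x) / v0_hat x\<close>
  that appears in the energy.\<close>

lemma v0_hat_weight:
  "v0_hat x > 0" "v0_hat x < 1" "exp x * v0_hat x \<le> 1" "v0_hat x \<le> exp (- x)"
  "(1 + exp (- x)) * v0_hat x = exp (- x)"
proof -
  have [simp]: "1 + exp x > 0" "1 + exp x \<noteq> 0" by (smt (verit) exp_gt_zero)+
  show "v0_hat x > 0" "v0_hat x < 1" "exp x * v0_hat x \<le> 1"
    by (auto simp: v0_hat_logistic field_simps)
  then show "v0_hat x \<le> exp (- x)" by (simp add: exp_minus field_simps)
  show "(1 + exp (- x)) * v0_hat x = exp (- x)"
    by (simp add: v0_hat_logistic exp_minus field_simps)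
qed

text \<open>If \<open>s\<^sup>2 = 1 + 4 l\<close>, then \<open>(Re s)\<^sup>2 \<ge> Re (s\<^sup>2) \<ge> 1\<close>. This
  exceeds \<open>1 / 2\<close>, so that a quadratic expression in \<open>W\<close> times the weight
  \<open>exp (- x)\<close> still vanishes at \<open>-\<infinity>\<close>.\<close>

lemma Re_mu_ge_1:
  assumes "0 \<le> Re l"
  shows "1 \<le> Re (mu l)"
proof -
  let ?s = "csqrt (1 + 4 * l)"
  have "Re (?s\<^sup>2) \<ge> 1" unfolding power2_csqrt using assms by (simp del: csqrt.sel)
  then have "1\<^sup>2 \<le> (Re ?s)\<^sup>2" using zero_le_power2[of "Im ?s"] unfolding Re_power2 one_power2 by linarith
  then have "1 \<le> Re ?s" by (rule power2_le_imp_le) (rule Re_csqrt)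
  then show ?thesis by (simp add: mu_def)
qed

lemma DERIV_inner:
  fixes f g :: "real \<Rightarrow> 'a::real_inner"
  assumes "(f has_vector_derivative f') (at x)" "(g has_vector_derivative g') (at x)"
  shows "((\<lambda>x. f x \<bullet> g x) has_real_derivative (f x \<bullet> g' + f' \<bullet> g x)) (at x)"
  using bounded_bilinear.has_vector_derivative[OF bounded_bilinear_inner assms]
  by (simp add: has_real_derivative_iff_has_vector_derivative)

lemma constant_if_vector_derivative_zero:
  fixes f :: "real \<Rightarrow> 'a::real_normed_vector"
  assumes "\<And>x. (f has_vector_derivative 0) (at x)"
  shows "f x = f y"
proof -
  obtain c where "\<And>x. x \<in> UNIV \<Longrightarrow> f x = c"
    by (rule has_vector_derivative_zero_constant[OF convex_UNIV, of f]) (use assms in auto)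
  then show ?thesis by simp
qed

text \<open>The integral of the derivative from \<open>x\<close> to \<open>+\<infinity>\<close>, estimated by comparison with
  \<open>- C exp (- x)\<close>.\<close>

lemma norm_le_exp_if_deriv_le_exp:
  fixes f :: "real \<Rightarrow> 'a::real_normed_vector"
  assumes lim: "(f \<longlongrightarrow> 0) at_top"
    and deriv: "\<And>x. (f has_vector_derivative f' x) (at x)"
    and bound: "\<And>x. X \<le> x \<Longrightarrow> norm (f' x) \<le> C * exp (- x)"
    and "X \<le> x" and "C \<ge> 0"
  shows "norm (f x) \<le> C * exp (- x)"
proof -
  have step: "norm (f y - f x) \<le> C * exp (- x)" if "x < y" for y
  proof -
    have "norm (f y - f x) \<le> - C * exp (- y) - (- C * exp (- x))"
    proof (rule differentiable_bound_general[OF that, where f' = f' and \<phi>' = "\<lambda>x. C * exp (- x)"])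
      show "continuous_on {x..y} f"
        by (intro continuous_at_imp_continuous_on ballI
              has_vector_derivative_continuous[OF deriv])
      show "continuous_on {x..y} (\<lambda>x. - C * exp (- x))" by (intro continuous_intros)
      show "((\<lambda>x. - C * exp (- x)) has_vector_derivative C * exp (- t)) (at t)" for t
        by (auto intro!: derivative_eq_intros
              simp flip: has_real_derivative_iff_has_vector_derivative)
    qed (use deriv bound \<open>X \<le> x\<close> in auto)
    also have "\<dots> \<le> C * exp (- x)" using \<open>C \<ge> 0\<close> by simp
    finally show ?thesis .
  qed
  have "((\<lambda>y. norm (f y - f x)) \<longlongrightarrow> norm (0 - f x)) at_top"
    by (intro tendsto_intros lim)
  then have "norm (0 - f x) \<le> C * exp (- x)"
    by (rule tendsto_upperbound)
       (auto intro: eventually_mono[OF eventually_gt_at_top[of x]] step)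
  then show ?thesis by simp
qed

section \<open>The energy of a solution\<close>

text \<open>On complex numbers \<open>a \<bullet> b = Re (a * cnj b)\<close>, so the inner product takes the
  real part of the sesquilinear energy terms.\<close>

lemma inner_mult_self: "(l * a) \<bullet> a = Re l * (norm a)\<^sup>2" for a l :: complex
  by (simp add: inner_complex_def cmod_power2 power2_eq_square[of "Re a"]
        power2_eq_square[of "Im a"] algebra_simps)

text \<open>The system \<open>W' = A\<^sup>0 W\<close> in components.\<close>

locale eigenvalue_ode =
  fixes l :: complex and u v w :: "real \<Rightarrow> complex"
  assumes Re_nonneg: "0 \<le> Re l"
    and u_deriv: "(u has_vector_derivative l * v x + w x) (at x)"
    and v_deriv: "(v has_vector_derivative w x) (at x)"
    and w_deriv: "(w has_vector_derivative
          l * v0_hat x * u x + l * v0_hat x * v x + (2 * v0_hat x - 1 - l) * w x) (at x)"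
begin

definition z :: "real \<Rightarrow> complex" where
  "z x = l * v x + w x"

text \<open>The term \<open>v \<bullet> v / 2\<close> is there because \<open>v \<bullet> u'\<close>, left over from integrating
  \<open>v' \<bullet> u\<close> by parts, contains the derivative of \<open>\<bar>v\<bar>\<^sup>2 / 2\<close> besides a nonnegative
  part.\<close>

definition energy :: "real \<Rightarrow> real" where
  "energy x = ((1 + exp (- x)) *\<^sub>R z x + v x) \<bullet> u x - v x \<bullet> v x / 2"

definition dissipation :: "real \<Rightarrow> real" where
  "dissipation x = Re l * (exp (- x) * (norm (u x))\<^sup>2 + (norm (v x))\<^sup>2)
     + (1 + exp (- x)) * (norm (z x))\<^sup>2"

lemma u_deriv_z: "(u has_vector_derivative z x) (at x)"
  using u_deriv by (simp add: z_def)

lemma z_deriv: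
  "(z has_vector_derivative (v0_hat x *\<^sub>R (l * u x + z x) - (1 - v0_hat x) *\<^sub>R w x)) (at x)"
  unfolding z_def[abs_def]
  by (rule derivative_eq_intros v_deriv w_deriv refl)+
     (simp add: algebra_simps scaleR_conv_of_real)

text \<open>The derivative of the weight cancels the \<open>z\<close> term of \<open>z'\<close>, and
  \<open>(1 + exp (- x)) (1 - v0_hat x) = 1\<close> makes the coefficient of \<open>w = v'\<close> constant. This
  is what fixes the choice of the weight.\<close>

lemma weighted_z_deriv:
  "((\<lambda>x. (1 + exp (- x)) *\<^sub>R z x) has_vector_derivative (exp (- x) *\<^sub>R (l * u x) - w x)) (at x)"
proof -
  have e: "exp (- x) = v0_hat x + exp (- x) * v0_hat x"
    using v0_hat_weight(5)[of x] by (simp add: algebra_simps)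
  have "((\<lambda>x. 1 + exp (- x)) has_real_derivative (- exp (- x))) (at x)"
    by (auto intro!: derivative_eq_intros)
  from has_vector_derivative_scaleR[OF this z_deriv]
  have d: "((\<lambda>x. (1 + exp (- x)) *\<^sub>R z x) has_vector_derivative
      (1 + exp (- x)) *\<^sub>R (v0_hat x *\<^sub>R (l * u x + z x) - (1 - v0_hat x) *\<^sub>R w x)
        + (- exp (- x)) *\<^sub>R z x) (at x)" .
  have m: "(1 + exp (- x)) * (1 - v0_hat x) = 1"
    using v0_hat_weight(5)[of x] by (simp add: algebra_simps)
  have "(1 + exp (- x)) *\<^sub>R (v0_hat x *\<^sub>R (l * u x + z x) - (1 - v0_hat x) *\<^sub>R w x)
        + (- exp (- x)) *\<^sub>R z x = exp (- x) *\<^sub>R (l * u x) - w x"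
    unfolding scaleR_diff_right scaleR_scaleR m v0_hat_weight(5) by (simp add: algebra_simps)
  with d show ?thesis by simp
qed

text \<open>The two terms \<open>w \<bullet> u\<close> cancel, and \<open>v \<bullet> z = Re l \<bar>v\<bar>\<^sup>2 + v \<bullet> w\<close> loses its
  indefinite part \<open>v \<bullet> w\<close> to the derivative of \<open>v \<bullet> v / 2\<close>.\<close>

lemma energy_deriv: "(energy has_real_derivative dissipation x) (at x)"
proof -
  let ?m = "\<lambda>x. (1 + exp (- x)) *\<^sub>R z x"
  have "(energy has_real_derivative
      ((?m x + v x) \<bullet> z x + (exp (- x) *\<^sub>R (l * u x) - w x + w x) \<bullet> u x)
      - (v x \<bullet> w x + w x \<bullet> v x) / 2) (at x)"
    unfolding energy_def[abs_def]
    by (intro DERIV_diff DERIV_cdivide DERIV_inner has_vector_derivative_add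
          weighted_z_deriv v_deriv u_deriv_z)
  moreover have "((?m x + v x) \<bullet> z x + (exp (- x) *\<^sub>R (l * u x) - w x + w x) \<bullet> u x)
      - (v x \<bullet> w x + w x \<bullet> v x) / 2 = dissipation x"
  proof -
    have "v x \<bullet> z x = Re l * (norm (v x))\<^sup>2 + v x \<bullet> w x"
      by (simp add: z_def inner_add_right inner_commute[of "v x" "l * v x"] inner_mult_self)
    then show ?thesis
      by (simp add: dissipation_def inner_add_left inner_mult_self power2_norm_eq_inner
            inner_commute[of "w x" "v x"] algebra_simps)
  qed
  ultimately show ?thesis by simp
qed

lemma dissipation_nonneg: "dissipation x \<ge> 0"
  unfolding dissipation_def using Re_nonneg by simp

lemma energy_mono: "x \<le> y \<Longrightarrow> energy x \<le> energy y"
  by (meson DERIV_nonneg_imp_nondecreasing energy_deriv dissipation_nonneg)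

section \<open>Growth at plus infinity\<close>

text \<open>At \<open>+\<infinity>\<close> the system has a Jordan block for the eigenvalue \<open>0\<close>, through
  \<open>u' = l v + w\<close>, and the eigenvalue \<open>-1 - l\<close>. The large factor in front of \<open>v \<bullet> v\<close>
  makes the off-diagonal entry \<open>l\<close> of the Jordan block small, so that the exponential rate
  of growth is at most \<open>1 / 4\<close>. The factor \<open>exp x\<close> in front of \<open>w \<bullet> w\<close> still leaves
  a decaying quantity up to the coupling, since \<open>\<bar>w\<bar>\<^sup>2\<close> decays like
  \<open>exp (- 2 x)\<close> or faster without it, and it makes every contribution of \<open>w\<close> to the
  other components integrable.\<close>

definition growth :: "real \<Rightarrow> real" where
  "growth x = u x \<bullet> u x + (1 + 4 * norm l)\<^sup>2 * (v x \<bullet> v x) + exp x * (w x \<bullet> w x)"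

text \<open>The term \<open>1 / 4\<close> is the Jordan block contribution
  \<open>2 \<bar>u\<bar> \<bar>l\<bar> \<bar>v\<bar> \<le> \<bar>u\<bar> (1 + 4 \<bar>l\<bar>) \<bar>v\<bar> / 2\<close>; all others carry a factor
  \<open>exp (- x / 2)\<close>, which comes from \<open>\<bar>w\<bar> = exp (- x / 2) (exp (x / 2) \<bar>w\<bar>)\<close> or from
  \<open>v0_hat x \<le> exp (- x)\<close>.\<close>

lemma growth_deriv_le:
  assumes "0 \<le> x"
  obtains D where "(growth has_real_derivative D) (at x)"
    "D \<le> (1 / 4 + (6 + 6 * norm l) * exp (- x / 2)) * growth x"
proof
  let ?K = "1 + 4 * norm l" and ?h = "v0_hat x"
  let ?w' = "l * ?h * u x + l * ?h * v x + (2 * ?h - 1 - l) * w x"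
  let ?D = "(u x \<bullet> z x + z x \<bullet> u x) + ?K\<^sup>2 * (v x \<bullet> w x + w x \<bullet> v x)
     + (exp x * (w x \<bullet> w x) + (w x \<bullet> ?w' + ?w' \<bullet> w x) * exp x)"
  show "(growth has_real_derivative ?D) (at x)"
    unfolding growth_def[abs_def]
    by (intro DERIV_add DERIV_mult DERIV_cmult DERIV_inner DERIV_exp u_deriv_z v_deriv w_deriv)
  define a b c s where "a = norm (u x)" and "b = ?K * norm (v x)"
    and "c = exp (x / 2) * norm (w x)" and "s = exp (- x / 2)"
  have pos: "a \<ge> 0" "b \<ge> 0" "c \<ge> 0" "s > 0" by (auto simp: a_def b_def c_def s_def)
  have g: "growth x = a\<^sup>2 + b\<^sup>2 + c\<^sup>2"
    by (simp add: growth_def a_def b_def c_def power_mult_distrib power2_norm_eq_inner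
          flip: exp_double)
  have ww: "norm (w x) = s * c"
    by (simp add: s_def c_def flip: exp_add mult.assoc)
  have am: "2 * p * q \<le> p\<^sup>2 + q\<^sup>2" for p q :: real
    using sum_squares_bound .
  have u_part: "u x \<bullet> z x + z x \<bullet> u x \<le> (a\<^sup>2 + b\<^sup>2) / 4 + s * (a\<^sup>2 + c\<^sup>2)"
  proof -
    have "norm (z x) \<le> norm l * norm (v x) + norm (w x)"
      unfolding z_def by (metis norm_mult norm_triangle_ineq)
    also have "\<dots> \<le> b / 4 + s * c"
      by (simp add: b_def ww algebra_simps)
    finally have "a * norm (z x) \<le> a * (b / 4 + s * c)"
      using pos by (intro mult_left_mono)
    moreover have "u x \<bullet> z x \<le> a * norm (z x)"
      unfolding a_def by (rule norm_cauchy_schwarz)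
    ultimately have "2 * (u x \<bullet> z x) \<le> 2 * a * b / 4 + s * (2 * a * c)"
      by (simp add: algebra_simps)
    also have "2 * a * b / 4 \<le> (a\<^sup>2 + b\<^sup>2) / 4"
      by (intro divide_right_mono am) auto
    also have "s * (2 * a * c) \<le> s * (a\<^sup>2 + c\<^sup>2)"
      using pos by (intro mult_left_mono am) auto
    finally show ?thesis by (simp add: inner_commute[of "z x"])
  qed
  have v_part: "?K\<^sup>2 * (v x \<bullet> w x + w x \<bullet> v x) \<le> ?K * s * (b\<^sup>2 + c\<^sup>2)"
  proof -
    have "?K\<^sup>2 * (v x \<bullet> w x) \<le> ?K\<^sup>2 * (norm (v x) * norm (w x))"
      by (intro mult_left_mono norm_cauchy_schwarz) auto
    also have "\<dots> = ?K * s * (b * c)"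
      by (simp add: ww b_def power2_eq_square)
    finally have "?K\<^sup>2 * (v x \<bullet> w x + w x \<bullet> v x) \<le> ?K * s * (2 * b * c)"
      by (simp add: inner_commute[of "w x"] algebra_simps)
    also have "\<dots> \<le> ?K * s * (b\<^sup>2 + c\<^sup>2)"
      using pos by (intro mult_left_mono am) auto
    finally show ?thesis .
  qed
  have w_part: "exp x * (w x \<bullet> w x) + (w x \<bullet> ?w' + ?w' \<bullet> w x) * exp x
      \<le> s * (norm l * (a\<^sup>2 + b\<^sup>2 + 2 * c\<^sup>2) + 4 * c\<^sup>2)"
  proof -
    define q where "q = w x \<bullet> ?w'"
    have cc: "exp x * (w x \<bullet> w x) = c\<^sup>2"
      by (simp add: c_def power_mult_distrib power2_norm_eq_inner flip: exp_double)
    have "?w' = ?h *\<^sub>R (l * (u x + v x)) + (2 * ?h - 1) *\<^sub>R w x - l * w x"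
      by (simp add: scaleR_conv_of_real algebra_simps)
    moreover have "w x \<bullet> (l * w x) \<ge> 0"
      using Re_nonneg inner_mult_self[of l "w x"] by (simp add: inner_commute)
    ultimately have "w x \<bullet> ?w' \<le> ?h * (w x \<bullet> (l * (u x + v x))) + (2 * ?h - 1) * (w x \<bullet> w x)"
      by (simp add: inner_add_right inner_diff_right)
    then have "exp x * q \<le>
        exp x * (?h * (w x \<bullet> (l * (u x + v x))) + (2 * ?h - 1) * (w x \<bullet> w x))"
      unfolding q_def by (intro mult_left_mono) auto
    also have "\<dots> = (exp x * ?h) * (w x \<bullet> (l * (u x + v x))) + (2 * ?h - 1) * c\<^sup>2"
      by (simp add: cc[symmetric] algebra_simps)
    also have "(exp x * ?h) * (w x \<bullet> (l * (u x + v x))) \<le> s * c * (norm l * (a + b))"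
    proof -
      have "w x \<bullet> (l * (u x + v x)) \<le> norm (w x) * norm (l * (u x + v x))"
        by (rule norm_cauchy_schwarz)
      also have "norm (l * (u x + v x)) \<le> norm l * (norm (u x) + norm (v x))"
        by (simp add: norm_mult mult_left_mono norm_triangle_ineq)
      also have "norm (v x) \<le> b" by (simp add: b_def mult_le_cancel_right1)
      finally have "w x \<bullet> (l * (u x + v x)) \<le> s * c * (norm l * (a + b))"
        using pos by (simp add: ww a_def mult_left_mono)
      then have "(exp x * ?h) * (w x \<bullet> (l * (u x + v x)))
          \<le> (exp x * ?h) * (s * c * (norm l * (a + b)))"
        using v0_hat_weight(1)[of x] by (intro mult_left_mono) auto
      also have "\<dots> \<le> 1 * (s * c * (norm l * (a + b)))"
        using v0_hat_weight(3)[of x] pos by (intro mult_right_mono) auto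
      finally show ?thesis by simp
    qed
    finally have "exp x * q \<le> s * c * (norm l * (a + b)) + (2 * ?h - 1) * c\<^sup>2"
      by simp
    moreover have "(norm l * s) * (2 * a * c + 2 * b * c) \<le> (norm l * s) * (a\<^sup>2 + b\<^sup>2 + 2 * c\<^sup>2)"
      using pos am[of a c] am[of b c] by (intro mult_left_mono) auto
    moreover have "?h * c\<^sup>2 \<le> s * c\<^sup>2"
    proof -
      have "?h \<le> exp (- x)" by (rule v0_hat_weight)
      also have "\<dots> \<le> s" using \<open>0 \<le> x\<close> by (simp add: s_def)
      finally show ?thesis by (intro mult_right_mono) auto
    qed
    ultimately have "2 * (exp x * q) + 2 * c\<^sup>2
        \<le> s * (norm l * (a\<^sup>2 + b\<^sup>2 + 2 * c\<^sup>2) + 4 * c\<^sup>2)"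
      by (simp add: algebra_simps)
    moreover have "exp x * (w x \<bullet> w x) + (w x \<bullet> ?w' + ?w' \<bullet> w x) * exp x
        = 2 * (exp x * q) + c\<^sup>2"
      unfolding cc inner_commute[of ?w' "w x"] q_def[symmetric] by simp
    moreover have "c\<^sup>2 \<ge> 0" by simp
    ultimately show ?thesis by linarith
  qed
  have "?D \<le> (a\<^sup>2 + b\<^sup>2) / 4 + s * (a\<^sup>2 + c\<^sup>2) + ?K * s * (b\<^sup>2 + c\<^sup>2)
      + s * (norm l * (a\<^sup>2 + b\<^sup>2 + 2 * c\<^sup>2) + 4 * c\<^sup>2)"
    using u_part v_part w_part by linarith
  also have "\<dots> \<le> (1 / 4 + (6 + 6 * norm l) * s) * (a\<^sup>2 + b\<^sup>2 + c\<^sup>2)"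
  proof -
    have "(1 / 4 + (6 + 6 * norm l) * s) * (a\<^sup>2 + b\<^sup>2 + c\<^sup>2) - ((a\<^sup>2 + b\<^sup>2) / 4
        + s * (a\<^sup>2 + c\<^sup>2) + ?K * s * (b\<^sup>2 + c\<^sup>2)
        + s * (norm l * (a\<^sup>2 + b\<^sup>2 + 2 * c\<^sup>2) + 4 * c\<^sup>2))
      = c\<^sup>2 / 4 + s * ((5 + 5 * norm l) * a\<^sup>2 + (5 + norm l) * b\<^sup>2)"
      by (simp add: algebra_simps)
    also have "\<dots> \<ge> 0" using pos by simp
    finally show ?thesis by simp
  qed
  finally show "?D \<le> (1 / 4 + (6 + 6 * norm l) * exp (- x / 2)) * growth x"
    by (simp add: g s_def)
qed

lemma growth_nonneg: "growth x \<ge> 0"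
  by (simp add: growth_def)

text \<open>Gronwall: the second factor of \<open>H\<close> below is the integrating factor, and
  the integrable part \<open>B / 2 * exp (- x / 2)\<close> of the rate costs only the factor
  \<open>exp B\<close>.\<close>

lemma growth_bound:
  obtains C where "C \<ge> 0" "\<And>x. 0 \<le> x \<Longrightarrow> growth x \<le> C * exp (x / 4)"
proof
  define B where "B = 2 * (6 + 6 * norm l)"
  define H where "H = (\<lambda>x. growth x * exp (B * exp (- x / 2) - x / 4))"
  show "growth 0 * exp B \<ge> 0" by (simp add: growth_nonneg)
  fix x :: real assume "0 \<le> x"
  have "H x \<le> H 0"
  proof (rule DERIV_nonpos_imp_nonincreasing[OF \<open>0 \<le> x\<close>])
    fix t assume "0 \<le> t" "t \<le> x"
    have B: "6 + 6 * norm l = B / 2" by (simp add: B_def)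
    obtain D where D: "(growth has_real_derivative D) (at t)"
        "D \<le> (1 / 4 + B / 2 * exp (- t / 2)) * growth t"
      using growth_deriv_le[OF \<open>0 \<le> t\<close>] unfolding B by blast
    let ?E = "exp (B * exp (- t / 2) - t / 4)"
    have "((\<lambda>x. exp (B * exp (- x / 2) - x / 4)) has_real_derivative
        ?E * (- B / 2 * exp (- t / 2) - 1 / 4)) (at t)"
      by (auto intro!: derivative_eq_intros)
    from DERIV_mult[OF D(1) this] have "(H has_real_derivative
        ?E * (D - (1 / 4 + B / 2 * exp (- t / 2)) * growth t)) (at t)"
      unfolding H_def by (simp add: algebra_simps)
    moreover have "?E * (D - (1 / 4 + B / 2 * exp (- t / 2)) * growth t) \<le> 0"
      using D(2) by (simp add: mult_le_0_iff)
    ultimately show "\<exists>y. (H has_real_derivative y) (at t) \<and> y \<le> 0" by blast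
  qed
  moreover have "growth x * exp (- x / 4) \<le> H x"
    unfolding H_def by (intro mult_left_mono growth_nonneg) (simp add: B_def)
  ultimately have "growth x * exp (- x / 4) \<le> growth 0 * exp B"
    by (simp add: H_def)
  then have "growth x * exp (- x / 4) * exp (x / 4) \<le> growth 0 * exp B * exp (x / 4)"
    by (rule mult_right_mono) simp
  then show "growth x \<le> growth 0 * exp B * exp (x / 4)"
    by (simp add: mult.assoc flip: exp_add)
qed

text \<open>These are the products that remain in the upper bound of the energy at \<open>+\<infinity>\<close>. A
  growth rate below \<open>1 / 2\<close> suffices for all three; the last one decays because
  \<open>growth\<close> controls \<open>exp (x / 2) \<bar>w\<bar>\<close>.\<close>

lemma products_at_top:
  shows "((\<lambda>x. exp (- x) * (norm (u x) * norm (u x))) \<longlongrightarrow> 0) at_top"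
    and "((\<lambda>x. exp (- x) * (norm (v x) * norm (u x))) \<longlongrightarrow> 0) at_top"
    and "((\<lambda>x. norm (w x) * norm (u x)) \<longlongrightarrow> 0) at_top"
proof -
  obtain C where C: "C \<ge> 0" "\<And>x. 0 \<le> x \<Longrightarrow> growth x \<le> C * exp (x / 4)"
    by (rule growth_bound) blast
  let ?K = "1 + 4 * norm l"
  have parts: "(norm (u x))\<^sup>2 + (norm (v x))\<^sup>2 + (exp (x / 2) * norm (w x))\<^sup>2 \<le> C * exp (x / 4)"
    if "0 \<le> x" for x
  proof -
    have "1 * (v x \<bullet> v x) \<le> ?K\<^sup>2 * (v x \<bullet> v x)"
      by (intro mult_right_mono one_le_power) auto
    moreover have "(exp (x / 2) * norm (w x))\<^sup>2 = exp x * (w x \<bullet> w x)"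
      by (simp add: power_mult_distrib power2_norm_eq_inner flip: exp_double)
    ultimately show ?thesis
      using C(2)[OF that] by (simp add: growth_def power2_norm_eq_inner)
  qed
  have nonneg: "(norm (u x))\<^sup>2 \<ge> 0" "(norm (v x))\<^sup>2 \<ge> 0" "(exp (x / 2) * norm (w x))\<^sup>2 \<ge> 0" for x
    by auto
  have lim: "((\<lambda>x. C * exp (- 3 * x / 4)) \<longlongrightarrow> 0) at_top" "((\<lambda>x. C * exp (- x / 4)) \<longlongrightarrow> 0) at_top"
    by real_asymp+
  have ex: "exp (- x) * (C * exp (x / 4)) = C * exp (- 3 * x / 4)"
    "exp (- x / 2) * (C * exp (x / 4)) = C * exp (- x / 4)" for x :: real
    by (simp_all add: field_simps flip: exp_add) 
  note ev = eventually_mono[OF eventually_ge_at_top[of "0 :: real"]]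
  show "((\<lambda>x. exp (- x) * (norm (u x) * norm (u x))) \<longlongrightarrow> 0) at_top"
  proof (rule tendsto_sandwich[OF _ ev tendsto_const lim(1)])
    fix x :: real assume "0 \<le> x"
    have "norm (u x) * norm (u x) \<le> C * exp (x / 4)"
      using parts[OF \<open>0 \<le> x\<close>] nonneg[of x] unfolding power2_eq_square[symmetric] by linarith
    then show "exp (- x) * (norm (u x) * norm (u x)) \<le> C * exp (- 3 * x / 4)"
      unfolding ex(1)[symmetric] by (rule mult_left_mono) simp
  qed simp
  show "((\<lambda>x. exp (- x) * (norm (v x) * norm (u x))) \<longlongrightarrow> 0) at_top"
  proof (rule tendsto_sandwich[OF _ ev tendsto_const lim(1)])
    fix x :: real assume "0 \<le> x"
    have "norm (v x) * norm (u x) \<le> C * exp (x / 4)"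
      using parts[OF \<open>0 \<le> x\<close>] nonneg[of x] sum_squares_bound[of "norm (v x)" "norm (u x)"]
        mult_nonneg_nonneg[OF norm_ge_zero[of "v x"] norm_ge_zero[of "u x"]] by linarith
    then show "exp (- x) * (norm (v x) * norm (u x)) \<le> C * exp (- 3 * x / 4)"
      unfolding ex(1)[symmetric] by (rule mult_left_mono) simp
  qed simp
  show "((\<lambda>x. norm (w x) * norm (u x)) \<longlongrightarrow> 0) at_top"
  proof (rule tendsto_sandwich[OF _ ev tendsto_const lim(2)])
    fix x :: real assume "0 \<le> x"
    let ?c = "exp (x / 2) * norm (w x)"
    have "0 \<le> ?c * norm (u x)" by simp
    then have "?c * norm (u x) \<le> C * exp (x / 4)"
      using parts[OF \<open>0 \<le> x\<close>] nonneg[of x] sum_squares_bound[of ?c "norm (u x)"] by linarith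
    then have "exp (- x / 2) * (?c * norm (u x)) \<le> C * exp (- x / 4)"
      unfolding ex(2)[symmetric] by (rule mult_left_mono) simp
    then show "norm (w x) * norm (u x) \<le> C * exp (- x / 4)"
      by (simp flip: exp_add mult.assoc)
  qed simp
qed


section \<open>Behaviour at minus infinity and triviality\<close>

text \<open>Every term of the energy is quadratic in \<open>W\<close>, hence \<open>O(exp (2 x))\<close>, and the
  weight costs only one factor \<open>exp (- x)\<close>.\<close>

lemma energy_at_bot:
  assumes "B \<ge> 0"
    and decay: "\<forall>\<^sub>F x in at_bot. norm (u x) \<le> B * exp x \<and> norm (v x) \<le> B * exp x
      \<and> norm (w x) \<le> B * exp x"
  shows "(energy \<longlongrightarrow> 0) at_bot"
proof (rule Lim_null_comparison)
  let ?M = "\<lambda>x. (norm l + 1) * B\<^sup>2 * (exp x + (exp x)\<^sup>2) + 3 / 2 * B\<^sup>2 * (exp x)\<^sup>2"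
  show "\<forall>\<^sub>F x in at_bot. norm (energy x) \<le> ?M x"
    using decay
  proof eventually_elim
    case (elim x)
    let ?b = "B * exp x"
    have "norm (z x) \<le> norm l * norm (v x) + norm (w x)"
      unfolding z_def by (metis norm_mult norm_triangle_ineq)
    also have "\<dots> \<le> norm l * ?b + ?b"
      using elim by (intro add_mono mult_left_mono) auto
    finally have z: "norm (z x) \<le> (norm l + 1) * ?b" by (simp add: algebra_simps)
    have "norm ((1 + exp (- x)) *\<^sub>R z x + v x)
        \<le> norm ((1 + exp (- x)) *\<^sub>R z x) + norm (v x)"
      by (rule norm_triangle_ineq)
    also have "norm ((1 + exp (- x)) *\<^sub>R z x) = (1 + exp (- x)) * norm (z x)"
      using exp_gt_zero[of "- x"] by (simp del: exp_gt_zero)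
    also have "\<dots> \<le> (1 + exp (- x)) * ((norm l + 1) * ?b)"
      using z by (intro mult_left_mono) auto
    finally have "norm ((1 + exp (- x)) *\<^sub>R z x + v x)
        \<le> (1 + exp (- x)) * ((norm l + 1) * ?b) + ?b"
      using elim by linarith
    moreover from this have "0 \<le> (1 + exp (- x)) * ((norm l + 1) * ?b) + ?b"
      by (rule order_trans[OF norm_ge_zero])
    ultimately have "\<bar>((1 + exp (- x)) *\<^sub>R z x + v x) \<bullet> u x\<bar>
        \<le> ((1 + exp (- x)) * ((norm l + 1) * ?b) + ?b) * ?b"
      using elim by (intro order_trans[OF Cauchy_Schwarz_ineq2] mult_mono) auto
    moreover have "v x \<bullet> v x \<le> ?b\<^sup>2"
      using elim by (simp add: power_mono flip: power2_norm_eq_inner)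
    ultimately have "\<bar>energy x\<bar>
        \<le> ((1 + exp (- x)) * ((norm l + 1) * ?b) + ?b) * ?b + ?b\<^sup>2 / 2"
      unfolding energy_def using inner_ge_zero[of "v x"] by linarith
    also have "\<dots> = (norm l + 1) * B\<^sup>2 * ((1 + exp (- x)) * exp x * exp x)
        + 3 / 2 * B\<^sup>2 * (exp x)\<^sup>2"
      by (simp add: power2_eq_square algebra_simps)
    also have "(1 + exp (- x)) * exp x * exp x = exp x + (exp x)\<^sup>2"
      by (simp add: power2_eq_square exp_minus field_simps)
    finally show ?case by simp
  qed
  have "(?M \<longlongrightarrow> (norm l + 1) * B\<^sup>2 * (0 + 0\<^sup>2) + 3 / 2 * B\<^sup>2 * 0\<^sup>2) at_bot"
    by (intro tendsto_intros exp_at_bot)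
  then show "(?M \<longlongrightarrow> 0) at_bot" by simp
qed

text \<open>The energy vanishes identically, hence so does its derivative and with it \<open>z = u'\<close>.
  So \<open>u\<close> is constant, thus zero by its limit. The equation for \<open>z'\<close> reduces to
  \<open>0 = - (1 - v0_hat) w\<close>, so \<open>w = v'\<close> vanishes, and finally \<open>v\<close>. Concluding for
  \<open>v\<close> from its limit covers \<open>l = 0\<close>, where \<open>z = 0\<close> says nothing about
  \<open>v\<close>.\<close>

lemma trivial_if_energy_nonpos:
  assumes "\<And>x. energy x \<le> 0" "(energy \<longlongrightarrow> 0) at_bot"
    and lim_u: "(u \<longlongrightarrow> 0) at_bot" and lim_v: "(v \<longlongrightarrow> 0) at_bot"
  shows "u x = 0" "v x = 0" "w x = 0"
proof -
  have const: "f = (\<lambda>x. 0)"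
    if deriv: "\<And>x. (f has_vector_derivative 0) (at x)" and lim: "(f \<longlongrightarrow> 0) at_bot"
    for f :: "real \<Rightarrow> complex"
  proof -
    define c where "c = f 0"
    have f: "f = (\<lambda>x. c)"
      unfolding c_def by (rule ext) (rule constant_if_vector_derivative_zero[OF deriv])
    have "((\<lambda>x::real. c) \<longlongrightarrow> 0) at_bot"
      using lim by (simp only: f)
    then have "c = 0" by (simp add: tendsto_const_iff)
    with f show ?thesis by simp
  qed
  have "energy x \<ge> 0" for x
  proof (rule tendsto_upperbound[OF assms(2)])
    show "\<forall>\<^sub>F y in at_bot. energy y \<le> energy x"
      using eventually_le_at_bot[of x] by eventually_elim (rule energy_mono)
  qed simp
  then have "energy = (\<lambda>x. 0)" using assms(1) by (intro ext antisym) auto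
  then have "dissipation x = 0" for x
    using DERIV_unique[OF energy_deriv[of x]] by simp
  then have "(1 + exp (- x)) * (norm (z x))\<^sup>2 \<le> 0" for x
    using Re_nonneg unfolding dissipation_def
    by (smt (verit) exp_gt_zero mult_nonneg_nonneg zero_le_power2)
  moreover have "1 + exp (- x) > 0" for x :: real by (smt (verit) exp_gt_zero)
  ultimately have z0: "z x = 0" for x
    by (smt (verit) mult_pos_pos norm_eq_zero zero_less_power2)
  have u0: "u = (\<lambda>x. 0)"
    using u_deriv_z lim_u by (intro const) (simp_all add: z0)
  have w0: "w x = 0" for x
  proof -
    have "(z has_vector_derivative - ((1 - v0_hat x) *\<^sub>R w x)) (at x)"
      using z_deriv[of x] by (simp add: u0 z0)
    moreover have "(z has_vector_derivative 0) (at x)"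
      using z0 by (simp add: ext[of z "\<lambda>_. 0"])
    ultimately have "(1 - v0_hat x) *\<^sub>R w x = 0"
      by (metis neg_equal_0_iff_equal vector_derivative_unique_at)
    then show ?thesis using v0_hat_weight(2)[of x] by simp
  qed
  have "v = (\<lambda>x. 0)"
    using v_deriv lim_v by (intro const) (simp_all add: w0)
  then show "u x = 0" "v x = 0" "w x = 0" using u0 w0 by auto
qed

end

section \<open>The adjoint solution\<close>

text \<open>Here \<open>(p1, p2, p3)\<close> is the complex conjugate of the adjoint solution. It satisfies
  \<open>p' = - (A\<^sup>0)\<^sup>T p\<close>, so the Evans function is the bilinear pairing of \<open>p\<close> with
  \<open>W\<close> and no conjugate of \<open>l\<close> occurs.\<close>

locale evans_pair = eigenvalue_ode +
  fixes p1 p2 p3 :: "real \<Rightarrow> complex"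
  assumes p1_deriv: "(p1 has_vector_derivative - (l * v0_hat x * p3 x)) (at x)"
    and p2_deriv: "(p2 has_vector_derivative - (l * p1 x + l * v0_hat x * p3 x)) (at x)"
    and p3_deriv: "(p3 has_vector_derivative
          - (p1 x + p2 x + (2 * v0_hat x - 1 - l) * p3 x)) (at x)"
    and p1_lim: "(p1 \<longlongrightarrow> 0) at_top"
    and p2_lim: "(p2 \<longlongrightarrow> 1) at_top"
    and p3_lim: "(p3 \<longlongrightarrow> inverse (1 + l)) at_top"
begin

lemma pairing_const:
  "p1 x * u x + p2 x * v x + p3 x * w x = p1 y * u y + p2 y * v y + p3 y * w y"
proof -
  have "((\<lambda>x. p1 x * u x + p2 x * v x + p3 x * w x) has_vector_derivative 0) (at x)" for x
    by (rule derivative_eq_intros p1_deriv p2_deriv p3_deriv u_deriv v_deriv w_deriv refl)+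
       (simp add: algebra_simps)
  then show ?thesis by (rule constant_if_vector_derivative_zero)
qed

text \<open>The derivatives of \<open>p1\<close> and then of \<open>p2\<close> are \<open>O(exp (- x))\<close>, because
  \<open>p3\<close> is bounded and \<open>v0_hat x \<le> exp (- x)\<close>. These rates are needed to beat the
  possible growth of \<open>u\<close> and \<open>v\<close>; for \<open>p3\<close>, which multiplies the decaying
  component \<open>w\<close>, convergence is enough.\<close>

lemma adjoint_rates:
  obtains C where "C \<ge> 0" "\<forall>\<^sub>F x in at_top. norm (p1 x) \<le> C * exp (- x)"
    "\<forall>\<^sub>F x in at_top. norm (p2 x - 1) \<le> C * exp (- x)"
proof -
  define M where "M = norm (inverse (1 + l)) + 1"
  have "M \<ge> 0" by (simp add: M_def)
  have "\<forall>\<^sub>F x in at_top. norm (p3 x) < M"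
    by (rule order_tendstoD(2)[OF tendsto_norm[OF p3_lim]]) (simp add: M_def)
  then obtain X where X: "\<And>x. X \<le> x \<Longrightarrow> norm (p3 x) \<le> M"
    by (auto simp: eventually_at_top_linorder intro: less_imp_le)
  have src: "norm (l * v0_hat x * p3 x) \<le> norm l * M * exp (- x)" if "X \<le> x" for x
  proof -
    have "norm (l * v0_hat x * p3 x) = norm l * v0_hat x * norm (p3 x)"
      using v0_hat_weight(1)[of x] by (simp add: norm_mult)
    also have "\<dots> \<le> norm l * exp (- x) * M"
      using v0_hat_weight(4)[of x] X[OF that] by (intro mult_mono mult_left_mono) auto
    finally show ?thesis by (simp add: mult_ac)
  qed
  have p1: "norm (p1 x) \<le> norm l * M * exp (- x)" if "X \<le> x" for x
    by (rule norm_le_exp_if_deriv_le_exp[OF p1_lim p1_deriv _ that])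
       (use src \<open>M \<ge> 0\<close> in auto)
  have p2: "norm (p2 x - 1) \<le> (norm l + 1) * (norm l * M) * exp (- x)" if "X \<le> x" for x
  proof (rule norm_le_exp_if_deriv_le_exp[OF _ _ _ that])
    show "((\<lambda>x. p2 x - 1) \<longlongrightarrow> 0) at_top" using p2_lim by (simp add: LIM_zero)
    show "((\<lambda>x. p2 x - 1) has_vector_derivative - (l * p1 x + l * v0_hat x * p3 x)) (at x)" for x
      by (rule derivative_eq_intros p2_deriv refl)+ simp
    fix x assume "X \<le> x"
    have "norm (l * p1 x + l * v0_hat x * p3 x) \<le> norm l * norm (p1 x) + norm (l * v0_hat x * p3 x)"
      by (metis norm_mult norm_triangle_ineq)
    also have "\<dots> \<le> norm l * (norm l * M * exp (- x)) + norm l * M * exp (- x)"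
      by (intro add_mono mult_left_mono p1 src \<open>X \<le> x\<close>) simp
    finally show "norm (- (l * p1 x + l * v0_hat x * p3 x)) \<le> (norm l + 1) * (norm l * M) * exp (- x)"
      unfolding norm_minus_cancel by (simp add: algebra_simps)
  qed (use \<open>M \<ge> 0\<close> in simp)
  define C where "C = (norm l + 1) * (norm l * M)"
  have le_C: "norm l * M \<le> C" unfolding C_def
    using \<open>M \<ge> 0\<close> mult_right_mono[of 1 "norm l + 1" "norm l * M"] by simp
  have p1': "norm (p1 x) \<le> C * exp (- x)" if "X \<le> x" for x
    by (rule order_trans[OF p1[OF that] mult_right_mono[OF le_C exp_ge_zero]])
  show thesis
  proof (rule that)
    show "C \<ge> 0" using \<open>M \<ge> 0\<close> by (simp add: C_def)
    show "\<forall>\<^sub>F x in at_top. norm (p1 x) \<le> C * exp (- x)"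
      using eventually_ge_at_top[of X] by eventually_elim (rule p1')
    show "\<forall>\<^sub>F x in at_top. norm (p2 x - 1) \<le> C * exp (- x)"
      unfolding C_def using eventually_ge_at_top[of X] by eventually_elim (rule p2)
  qed
qed

text \<open>A vanishing pairing expresses \<open>v + w / (1 + l)\<close> through the deviation of
  \<open>(p1, p2, p3)\<close> from its limit \<open>(0, 1, 1 / (1 + l))\<close>. As
  \<open>z + v = (1 + l) (v + w / (1 + l))\<close> is the leading factor of the energy, the energy has an
  upper bound that tends to \<open>0\<close>; by monotonicity it is nonpositive everywhere.\<close>

lemma energy_nonpos_if_pairing_zero:
  assumes zero: "p1 0 * u 0 + p2 0 * v 0 + p3 0 * w 0 = 0"
  shows "energy x \<le> 0"
proof -
  obtain C where C: "C \<ge> 0" "\<forall>\<^sub>F x in at_top. norm (p1 x) \<le> C * exp (- x)"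
    "\<forall>\<^sub>F x in at_top. norm (p2 x - 1) \<le> C * exp (- x)"
    by (rule adjoint_rates)
  \<comment> \<open>\<open>R\<close> is the upper bound of the energy; \<open>q\<close> is the deviation of \<open>p3\<close> from its limit.\<close>
  define q where "q x = p3 x - inverse (1 + l)" for x
  define U V Y where "U x = exp (- x) * (norm (u x) * norm (u x))"
    and "V x = exp (- x) * (norm (v x) * norm (u x))"
    and "Y x = norm (w x) * norm (u x)" for x
  define R where "R x = norm (1 + l) * (C * U x + C * V x + norm (q x) * Y x)
     + (norm l * V x + exp (- x) * Y x)" for x
  have l1: "1 + l \<noteq> 0"
    using Re_nonneg by (auto simp: complex_eq_iff)
  have q_lim: "(q \<longlongrightarrow> 0) at_top"
    unfolding q_def using p3_lim by (simp add: LIM_zero)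
  have exp_lim: "((\<lambda>x::real. exp (- x)) \<longlongrightarrow> 0) at_top" by real_asymp
  have "(R \<longlongrightarrow> norm (1 + l) * (C * 0 + C * 0 + norm (0::complex) * 0) + (norm l * 0 + 0 * 0)) at_top"
    unfolding R_def U_def V_def Y_def
    by (intro tendsto_intros products_at_top q_lim exp_lim)
  then have R_lim: "(R \<longlongrightarrow> 0) at_top" by simp
  have "\<forall>\<^sub>F y in at_top. energy y \<le> R y"
    using C(2,3)
  proof eventually_elim
    case (elim y)
    have "p1 y * u y + p2 y * v y + p3 y * w y = 0"
      using pairing_const[of y 0] zero by simp
    then have "(v y + inverse (1 + l) * w y) + (p1 y * u y + (p2 y - 1) * v y + q y * w y) = 0"
      by (simp add: q_def algebra_simps)
    then have "v y + inverse (1 + l) * w y = - (p1 y * u y + (p2 y - 1) * v y + q y * w y)"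
      by (simp only: eq_neg_iff_add_eq_0)
    moreover have "z y + v y = (1 + l) * (v y + inverse (1 + l) * w y)"
    proof -
      have "(1 + l) * (inverse (1 + l) * w y) = w y"
        by (simp only: mult.assoc[symmetric] right_inverse[OF l1] mult_1_left)
      then show ?thesis by (simp only: distrib_left[of "1 + l"]) (simp add: z_def algebra_simps)
    qed
    ultimately have "z y + v y = - ((1 + l) * (p1 y * u y + (p2 y - 1) * v y + q y * w y))"
      by (simp only: mult_minus_right)
    then have zv_eq: "norm (z y + v y)
        = norm (1 + l) * norm (p1 y * u y + (p2 y - 1) * v y + q y * w y)"
      by (simp only: norm_minus_cancel norm_mult)
    have "norm (p1 y * u y + (p2 y - 1) * v y + q y * w y)
        \<le> norm (p1 y * u y) + norm ((p2 y - 1) * v y) + norm (q y * w y)"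
      by (meson add_right_mono norm_triangle_ineq order_trans)
    also have "\<dots> \<le> C * exp (- y) * norm (u y) + C * exp (- y) * norm (v y) + norm (q y) * norm (w y)"
      unfolding norm_mult using elim by (intro add_mono mult_right_mono) auto
    finally have "norm (z y + v y) * norm (u y) \<le> norm (1 + l)
        * (C * exp (- y) * norm (u y) + C * exp (- y) * norm (v y) + norm (q y) * norm (w y)) * norm (u y)"
      unfolding zv_eq by (intro mult_left_mono mult_right_mono) auto
    also have "\<dots> = norm (1 + l) * (C * U y + C * V y + norm (q y) * Y y)"
      by (simp add: U_def V_def Y_def algebra_simps)
    finally have zv: "norm (z y + v y) * norm (u y)
        \<le> norm (1 + l) * (C * U y + C * V y + norm (q y) * Y y)" .
    have "norm (z y) \<le> norm l * norm (v y) + norm (w y)"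
      unfolding z_def by (metis norm_mult norm_triangle_ineq)
    then have "exp (- y) * (norm (z y) * norm (u y))
        \<le> exp (- y) * ((norm l * norm (v y) + norm (w y)) * norm (u y))"
      by (intro mult_left_mono mult_right_mono) auto
    also have "\<dots> = norm l * V y + exp (- y) * Y y"
      by (simp add: V_def Y_def algebra_simps)
    finally have ez: "exp (- y) * (norm (z y) * norm (u y)) \<le> norm l * V y + exp (- y) * Y y" .
    have "energy y = (z y + v y) \<bullet> u y + exp (- y) * (z y \<bullet> u y) - v y \<bullet> v y / 2"
      by (simp add: energy_def inner_add_left scaleR_add_left)
    also have "\<dots> \<le> norm (z y + v y) * norm (u y) + exp (- y) * (norm (z y) * norm (u y))"
      using norm_cauchy_schwarz[of "z y + v y" "u y"] inner_ge_zero[of "v y"]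
        mult_left_mono[OF norm_cauchy_schwarz[of "z y" "u y"] exp_ge_zero[of "- y"]]
      by linarith
    also have "\<dots> \<le> R y" unfolding R_def using zv ez by (rule add_mono)
    finally show ?case .
  qed
  then have "\<forall>\<^sub>F y in at_top. energy x \<le> R y"
    using eventually_ge_at_top[of x]
  proof eventually_elim
    case (elim y)
    then show ?case using energy_mono[of x y] by linarith
  qed
  then show ?thesis
    by (rule tendsto_lowerbound[OF R_lim]) simp
qed

end

section \<open>Nonvanishing of the Evans function\<close>

lemma solution_minus_components:
  fixes l :: complex and W :: "real \<Rightarrow> complex^3"
  assumes "solution_minus l V W"
  shows "((\<lambda>x. W x $ 1) has_vector_derivative l * W x $ 2 + W x $ 3) (at x)"
    and "((\<lambda>x. W x $ 2) has_vector_derivative W x $ 3) (at x)"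
    and "((\<lambda>x. W x $ 3) has_vector_derivative l * v0_hat x * W x $ 1 + l * v0_hat x * W x $ 2
          + (2 * v0_hat x - 1 - l) * W x $ 3) (at x)"
proof -
  have "((\<lambda>x. W x $ i) has_vector_derivative (A0 x l *v W x) $ i) (at x)" for i
    using assms unfolding solution_minus_def
    by (intro bounded_linear.has_vector_derivative[OF bounded_linear_vec_nth]) auto
  from this[of 1] this[of 2] this[of 3] show
    "((\<lambda>x. W x $ 1) has_vector_derivative l * W x $ 2 + W x $ 3) (at x)"
    "((\<lambda>x. W x $ 2) has_vector_derivative W x $ 3) (at x)"
    "((\<lambda>x. W x $ 3) has_vector_derivative l * v0_hat x * W x $ 1 + l * v0_hat x * W x $ 2
          + (2 * v0_hat x - 1 - l) * W x $ 3) (at x)"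
    by (simp_all add: A0_def Let_def matrix_vector_mult_def sum_3)
qed

lemma adjoint_solution_plus_components:
  fixes l :: complex and Z :: "real \<Rightarrow> complex^3"
  assumes "adjoint_solution_plus l Z"
  shows "((\<lambda>x. cnj (Z x $ 1)) has_vector_derivative - (l * v0_hat x * cnj (Z x $ 3))) (at x)"
    and "((\<lambda>x. cnj (Z x $ 2)) has_vector_derivative
          - (l * cnj (Z x $ 1) + l * v0_hat x * cnj (Z x $ 3))) (at x)"
    and "((\<lambda>x. cnj (Z x $ 3)) has_vector_derivative
          - (cnj (Z x $ 1) + cnj (Z x $ 2) + (2 * v0_hat x - 1 - l) * cnj (Z x $ 3))) (at x)"
    and "((\<lambda>x. cnj (Z x $ 1)) \<longlongrightarrow> 0) at_top"
    and "((\<lambda>x. cnj (Z x $ 2)) \<longlongrightarrow> 1) at_top"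
    and "((\<lambda>x. cnj (Z x $ 3)) \<longlongrightarrow> inverse (1 + l)) at_top"
proof -
  have "((\<lambda>x. cnj (Z x $ i)) has_vector_derivative
      cnj (((- conj_transpose (A0 x l)) *v Z x) $ i)) (at x)" for i
    using assms unfolding adjoint_solution_plus_def
    by (intro has_vector_derivative_cnj bounded_linear.has_vector_derivative[OF bounded_linear_vec_nth]) auto
  from this[of 1] this[of 2] this[of 3] show
    "((\<lambda>x. cnj (Z x $ 1)) has_vector_derivative - (l * v0_hat x * cnj (Z x $ 3))) (at x)"
    "((\<lambda>x. cnj (Z x $ 2)) has_vector_derivative
          - (l * cnj (Z x $ 1) + l * v0_hat x * cnj (Z x $ 3))) (at x)"
    "((\<lambda>x. cnj (Z x $ 3)) has_vector_derivative
          - (cnj (Z x $ 1) + cnj (Z x $ 2) + (2 * v0_hat x - 1 - l) * cnj (Z x $ 3))) (at x)"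
    by (simp_all add: A0_def Let_def matrix_vector_mult_def sum_3 conj_transpose_def algebra_simps)
  have "((\<lambda>x. cnj (Z x $ i)) \<longlongrightarrow> cnj (vector [0, 1, inverse (1 + cnj l)] $ i)) at_top" for i
    using assms unfolding adjoint_solution_plus_def by (intro tendsto_intros) auto
  from this[of 1] this[of 2] this[of 3] show
    "((\<lambda>x. cnj (Z x $ 1)) \<longlongrightarrow> 0) at_top"
    "((\<lambda>x. cnj (Z x $ 2)) \<longlongrightarrow> 1) at_top"
    "((\<lambda>x. cnj (Z x $ 3)) \<longlongrightarrow> inverse (1 + l)) at_top"
    by simp_all
qed

text \<open>The rescaled solution converges, hence is eventually bounded, and
  \<open>\<bar>exp (mu l x)\<bar> \<le> exp x\<close> for \<open>x \<le> 0\<close> as \<open>Re (mu l) \<ge> 1\<close>.\<close>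

lemma solution_minus_decay:
  fixes l :: complex and W :: "real \<Rightarrow> complex^3"
  assumes "0 \<le> Re l" "solution_minus l V W"
  obtains B where "B \<ge> 0" "\<forall>\<^sub>F x in at_bot. \<forall>i. norm (W x $ i) \<le> B * exp x"
proof
  let ?g = "\<lambda>x. exp (- mu l * complex_of_real x) *s W x"
  show "norm V + 1 \<ge> 0" by simp
  have "(?g \<longlongrightarrow> V) at_bot" using assms(2) by (simp add: solution_minus_def)
  then have "\<forall>\<^sub>F x in at_bot. norm (?g x) < norm V + 1"
    by (intro order_tendstoD(2)[OF tendsto_norm]) auto
  then show "\<forall>\<^sub>F x in at_bot. \<forall>i. norm (W x $ i) \<le> (norm V + 1) * exp x"
    using eventually_le_at_bot[of 0]
  proof eventually_elim
    case (elim x)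
    show ?case
    proof
      fix i
      have "norm (exp (- mu l * complex_of_real x) * W x $ i) \<le> norm V + 1"
        using Finite_Cartesian_Product.norm_nth_le[of "?g x" i] elim(1) by simp
      then have "exp (- (Re (mu l) * x)) * norm (W x $ i) \<le> norm V + 1"
        by (simp add: norm_mult)
      moreover have "exp (- x) \<le> exp (- (Re (mu l) * x))"
        using mult_right_mono_neg[OF Re_mu_ge_1[OF assms(1)] elim(2)] by simp
      ultimately have "exp (- x) * norm (W x $ i) \<le> norm V + 1"
        by (meson mult_right_mono norm_ge_zero order_trans)
      then have "exp x * (exp (- x) * norm (W x $ i)) \<le> exp x * (norm V + 1)"
        by (rule mult_left_mono) simp
      then show "norm (W x $ i) \<le> (norm V + 1) * exp x"
        by (simp add: mult.commute flip: exp_add mult.assoc)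
    qed
  qed
qed

theorem proposition3:
  fixes V1 :: "complex \<Rightarrow> complex^3"
    and W1 Wt1 :: "complex \<Rightarrow> real \<Rightarrow> complex^3"
  assumes "analytic_eigenvector V1"
    and "\<And>l. 0 \<le> Re l \<Longrightarrow> solution_minus l (V1 l) (W1 l)"
    and "\<And>l. 0 \<le> Re l \<Longrightarrow> adjoint_solution_plus l (Wt1 l)"
  shows "\<forall>l. 0 \<le> Re l \<longrightarrow> Evans0 Wt1 W1 l \<noteq> 0"
proof (intro allI impI notI)
  fix l assume l: "0 \<le> Re l" and zero: "Evans0 Wt1 W1 l = 0"
  let ?W = "W1 l" and ?Z = "Wt1 l"
  note W = assms(2)[OF l]
  interpret evans_pair l "\<lambda>x. ?W x $ 1" "\<lambda>x. ?W x $ 2" "\<lambda>x. ?W x $ 3"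
      "\<lambda>x. cnj (?Z x $ 1)" "\<lambda>x. cnj (?Z x $ 2)" "\<lambda>x. cnj (?Z x $ 3)"
    by unfold_locales
       (rule l solution_minus_components[OF W]
          adjoint_solution_plus_components[OF assms(3)[OF l]])+
  have energy: "energy x \<le> 0" for x
    using zero by (intro energy_nonpos_if_pairing_zero) (simp add: Evans0_def herm_prod_def sum_3)
  obtain B where B: "B \<ge> 0" "\<forall>\<^sub>F x in at_bot. \<forall>i. norm (?W x $ i) \<le> B * exp x"
    using solution_minus_decay[OF l W] .
  have energy_lim: "(energy \<longlongrightarrow> 0) at_bot"
    by (rule energy_at_bot[OF B(1)]) (use B(2) in eventually_elim, auto)
  have lim: "((\<lambda>x. ?W x $ i) \<longlongrightarrow> 0) at_bot" for i
  proof (rule Lim_null_comparison)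
    show "\<forall>\<^sub>F x in at_bot. norm (?W x $ i) \<le> B * exp x"
      using B(2) by eventually_elim auto
    show "((\<lambda>x. B * exp x) \<longlongrightarrow> 0) at_bot" by real_asymp
  qed
  have "?W x = 0" for x
    using trivial_if_energy_nonpos[OF energy energy_lim lim lim, of x]
    by (simp add: vec_eq_iff forall_3)
  then have "V1 l = 0"
    using W by (simp add: solution_minus_def tendsto_const_iff)
  then show False using assms(1) l by (simp add: analytic_eigenvector_def)
qed

end
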